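(* Let $1\le k\le n-1$ be integers and $K\subset\mathbb{R}^n$ a convex body. Suppose $\delta_L(K)<d_{n,k}(K)$. Then for any lattice packing $\{K+x\mid x\in L\}$ of translates of $K$ there exists an affine $k$-plane $A_k\subset\mathbb{R}^n$ such that $$\operatorname{int}\left(A_k+\left[\left(d_{n,k}(K)/\delta_L(K)\right)^{1/n}-1\right](-K)\right)$$ is disjoint to $\bigcup\{K+x\mid x\in L\}$.
   Context: A convex body in $\mathbb{R}^n$ is a compact convex set with non-empty interior. For a lattice $L\subset\mathbb{R}^n$ (of full rank), $D(L)$ is the absolute value of its determinant, and the density of the lattice of translates $\{K+x\mid x\in L\}$ of a convex body $K$ is $V(K)/D(L)$. It is a lattice packing if the bodies $K+x$, $x\in L$, have pairwise disjoint interiors. It is called $k$-impassable if each affine $k$-subspace of $\mathbb{R}^n$ meets some $K+x$, $x\in L$. $d_{n,k}(K)$ is the infimum of the densities of all $k$-impassable lattices of translates of $K$. $\delta_L(K)$ is the density of the densest lattice packing of translates of $K$. Sums of sets are Minkowski sums. *)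

theory Defs
  imports "HOL-Analysis.Analysis" "HOL-Library.Set_Algebras"
begin

definition convex_body :: "(real^'n) set \<Rightarrow> bool" where
  "convex_body K \<longleftrightarrow> compact K \<and> convex K \<and> interior K \<noteq> {}"

definition lattice_gen :: "real^'n^'n \<Rightarrow> (real^'n) set" where
  "lattice_gen B = {B *v z | z. \<forall>i. z $ i \<in> \<int>}"

definition lattice_basis :: "(real^'n) set \<Rightarrow> real^'n^'n \<Rightarrow> bool" where
  "lattice_basis L B \<longleftrightarrow> invertible B \<and> L = lattice_gen B"

definition full_lattice :: "(real^'n) set \<Rightarrow> bool" where
  "full_lattice L \<longleftrightarrow> (\<exists>B. lattice_basis L B)"

text \<open>The choice of basis is irrelevant, see \<open>lattice_det_eq\<close> below.\<close>

definition lattice_det :: "(real^'n) set \<Rightarrow> real" where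
  "lattice_det L = \<bar>det (SOME B. lattice_basis L B)\<bar>"

definition translates_density :: "(real^'n) set \<Rightarrow> (real^'n) set \<Rightarrow> real" where
  "translates_density K L = measure lebesgue K / lattice_det L"

definition lattice_packing :: "(real^'n) set \<Rightarrow> (real^'n) set \<Rightarrow> bool" where
  "lattice_packing K L \<longleftrightarrow>
     full_lattice L \<and> disjoint_family_on (\<lambda>x. interior ((+) x ` K)) L"

definition affine_subspace_of_dim :: "nat \<Rightarrow> (real^'n) set \<Rightarrow> bool" where
  "affine_subspace_of_dim k A \<longleftrightarrow> affine A \<and> aff_dim A = int k"

definition impassable_lattice :: "nat \<Rightarrow> (real^'n) set \<Rightarrow> (real^'n) set \<Rightarrow> bool" where
  "impassable_lattice k K L \<longleftrightarrow>
     full_lattice L \<and>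
     (\<forall>A. affine_subspace_of_dim k A \<longrightarrow> (\<exists>x\<in>L. A \<inter> (+) x ` K \<noteq> {}))"

text \<open>For a convex body \<open>K\<close> the set below is non-empty (a fine enough lattice even gives a
  covering) and bounded below by 0, so \<open>Inf\<close> on the reals is the usual infimum.\<close>

definition impassable_density :: "nat \<Rightarrow> (real^'n) set \<Rightarrow> real" where
  "impassable_density k K = Inf {translates_density K L | L. impassable_lattice k K L}"

text \<open>For a convex body \<open>K\<close> the set below is non-empty and bounded above by 1, and
  its supremum is attained, so it is the density of the densest lattice packing.\<close>

definition lattice_packing_density :: "(real^'n) set \<Rightarrow> real" where
  "lattice_packing_density K = Sup {translates_density K L | L. lattice_packing K L}"

lemma lattice_basis_change:
  fixes B C :: "real^'n^'n"
  assumes "lattice_basis L B" "lattice_basis L C"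
  obtains U :: "real^'n^'n" where "B = C ** U" "det U \<in> \<int>"
proof -
  have *: "\<exists>z. B *v axis j 1 = C *v z \<and> (\<forall>i. z $ i \<in> \<int>)" for j
  proof -
    have "B *v axis j 1 \<in> L"
      using assms(1) unfolding lattice_basis_def lattice_gen_def
      by (auto simp: axis_def intro!: exI[of _ "axis j 1"])
    then show ?thesis
      using assms(2) unfolding lattice_basis_def lattice_gen_def by auto
  qed
  then obtain z where z: "\<And>j. B *v axis j 1 = C *v z j" "\<And>j i. z j $ i \<in> \<int>"
    by metis
  define U :: "real^'n^'n" where "U = (\<chi> i j. z j $ i)"
  have "column j (C ** U) = C *v z j" for j
    by (simp add: vec_eq_iff column_def matrix_matrix_mult_def matrix_vector_mult_def U_def)
  then have "column j B = column j (C ** U)" for j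
    using z(1)[of j] by (simp add: matrix_vector_mult_basis)
  then have "B = C ** U"
    by (simp add: vec_eq_iff column_def)
  moreover have "det U \<in> \<int>"
    unfolding det_def U_def using z(2)
    by (intro Ints_sum Ints_mult Ints_prod) (auto)
  ultimately show ?thesis by (rule that)
qed

lemma lattice_basis_det_unique:
  assumes "lattice_basis L B" "lattice_basis L C"
  shows "\<bar>det B\<bar> = \<bar>det C\<bar>"
proof -
  have le: "\<bar>det C\<bar> \<le> \<bar>det B\<bar>" if bases: "lattice_basis L B" "lattice_basis L C" for B C
  proof -
    obtain U where U: "B = C ** U" "det U \<in> \<int>"
      using lattice_basis_change[OF bases] by blast
    have "det B \<noteq> 0"
      using bases(1) by (simp add: lattice_basis_def invertible_det_nz)
    then have "det U \<noteq> 0"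
      using U(1) by (auto simp: det_mul)
    then have "1 \<le> \<bar>det U\<bar>"
      using U(2) by (simp add: Ints_nonzero_abs_ge1)
    then show ?thesis
      using U(1) by (simp add: det_mul abs_mult mult_le_cancel_left1)
  qed
  show ?thesis using le[OF assms] le[OF assms(2,1)] by simp
qed

lemma lattice_det_eq:
  assumes "lattice_basis L B"
  shows "lattice_det L = \<bar>det B\<bar>"
  unfolding lattice_det_def
  using lattice_basis_det_unique[OF someI[of "lattice_basis L", OF assms] assms] .

end

theory Submission
  imports Defs
begin

text \<open>
  Put \<open>t = (d/\<delta>)\<^sup>1\<^sup>/\<^sup>n > 1\<close>. For \<open>0 < s < t\<close> the dilates \<open>x + s K\<close>, \<open>x \<in> L\<close>, have density less than \<open>d\<close>
  and so are not \<open>k\<close>-impassable: some \<open>k\<close>-plane misses all of them. The density of \<open>L\<close> may equal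
  \<open>\<delta>\<close>, so \<open>s = t\<close> is only reached as a limit: by compactness some \<open>k\<close>-plane \<open>A\<close> misses all
  \<open>x + t (int K)\<close>. A common point of \<open>int (A - (t - 1) K)\<close> and \<open>x + K\<close> can be moved slightly towards
  an interior point of \<open>x + K\<close>, and then yields a point of \<open>A\<close> in
  \<open>x + int K + (t - 1) K \<subseteq> x + t (int K)\<close>.
\<close>

section \<open>Volume of sets with distinct residues modulo the integer lattice\<close>

text \<open>Used to see that a bounded set meets only finitely many unit cells, so that finite sums
  of volumes suffice.\<close>

lemma finite_bounded_integer_vectors:
  fixes S :: "(real^'n) set"
  assumes "bounded S" "\<And>z i. z \<in> S \<Longrightarrow> z $ i \<in> \<int>"
  shows "finite S"
proof -
  obtain b where b: "\<And>x. x \<in> S \<Longrightarrow> norm x \<le> b"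
    using assms(1) bounded_iff by blast
  have "S \<subseteq> vec_lambda ` (PiE UNIV (\<lambda>_. real_of_int ` {- \<lfloor>b\<rfloor>..\<lfloor>b\<rfloor>}))"
  proof
    fix z assume z: "z \<in> S"
    have "z $ i \<in> real_of_int ` {- \<lfloor>b\<rfloor>..\<lfloor>b\<rfloor>}" for i
    proof -
      obtain m where m: "z $ i = of_int m"
        using assms(2)[OF z, of i] by (auto elim: Ints_cases)
      have "\<bar>z $ i\<bar> \<le> b"
        using component_le_norm_cart[of z i] b[OF z] by linarith
      then have "m \<le> \<lfloor>b\<rfloor>" "- m \<le> \<lfloor>b\<rfloor>"
        using m by (auto simp: le_floor_iff)
      then show ?thesis using m by auto
    qed
    then have "vec_nth z \<in> PiE UNIV (\<lambda>_. real_of_int ` {- \<lfloor>b\<rfloor>..\<lfloor>b\<rfloor>})"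
      by auto
    then show "z \<in> vec_lambda ` (PiE UNIV (\<lambda>_. real_of_int ` {- \<lfloor>b\<rfloor>..\<lfloor>b\<rfloor>}))"
      by (metis image_eqI vec_nth_inverse)
  qed
  moreover have "finite (vec_lambda ` (PiE (UNIV::'n set) (\<lambda>_. real_of_int ` {- \<lfloor>b\<rfloor>..\<lfloor>b\<rfloor>})))"
    by (intro finite_imageI finite_PiE) auto
  ultimately show ?thesis by (rule finite_subset)
qed

text \<open>Cut \<open>S\<close> along the half-open unit cells and translate each piece by its
  integer corner into the unit cube. Distinct points of \<open>S\<close> never differ by an integer
  vector, so the translated pieces \<open>G z\<close> stay disjoint and their total volume is at
  most that of the cube.\<close>

lemma measure_le_1_if_distinct_mod_integers:
  fixes S :: "(real^'n) set"
  assumes S: "S \<in> lmeasurable" and "bounded S"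
    and inj: "\<And>x y. x \<in> S \<Longrightarrow> y \<in> S \<Longrightarrow> \<forall>i. x $ i - y $ i \<in> \<int> \<Longrightarrow> x = y"
  shows "measure lebesgue S \<le> 1"
proof -
  define fl :: "real^'n \<Rightarrow> real^'n" where "fl x = (\<chi> i. of_int \<lfloor>x $ i\<rfloor>)" for x
  define G where "G z = (\<lambda>x. x - z) ` {x \<in> S. fl x = z}" for z
  obtain b where b: "\<And>x. x \<in> S \<Longrightarrow> norm x \<le> b"
    using assms(2) bounded_iff by blast
  have "norm (fl x) \<le> b + real CARD('n)" if "x \<in> S" for x
  proof -
    have "norm (x - fl x) \<le> (\<Sum>i\<in>UNIV. \<bar>(x - fl x) $ i\<bar>)"
      by (rule norm_le_l1_cart)
    also have "\<dots> \<le> (\<Sum>i\<in>(UNIV::'n set). 1)"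
      by (intro sum_mono) (auto simp: fl_def, linarith)
    finally have "norm (x - fl x) \<le> real CARD('n)" by simp
    then show ?thesis
      using b[OF that] norm_triangle_ineq4[of x "x - fl x"] by simp
  qed
  then have "bounded (fl ` S)"
    by (auto simp: bounded_iff)
  then have fin: "finite (fl ` S)"
    by (rule finite_bounded_integer_vectors) (auto simp: fl_def)
  have cell: "{x. fl x = z} \<in> sets lebesgue" for z
  proof -
    have "{x. fl x = z} = (\<Inter>i. {x. of_int \<lfloor>x $ i\<rfloor> = z $ i})"
      by (auto simp: fl_def vec_eq_iff)
    also have "\<dots> \<in> sets borel"
      by measurable
    finally show ?thesis by simp
  qed
  have meas: "{x \<in> S. fl x = z} \<in> lmeasurable" for z
  proof -
    have "{x \<in> S. fl x = z} = S \<inter> {x. fl x = z}" by auto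
    then show ?thesis
      using fmeasurable_Int_fmeasurable[OF S cell[of z]] by simp
  qed
  then have measG: "G z \<in> lmeasurable" for z
    unfolding G_def by (rule measurable_translation_subtract)
  have disj: "disjoint_family_on G (fl ` S)"
    unfolding disjoint_family_on_def
  proof (intro ballI impI)
    \<comment> \<open>A common point \<open>u = x - fl x = y - fl y\<close> makes
      \<open>x - y\<close> an integer vector, so \<open>inj\<close> gives \<open>x = y\<close> and
      the two cells coincide.\<close>
    fix z w assume zw: "z \<in> fl ` S" "w \<in> fl ` S" "z \<noteq> w"
    have False if u: "u \<in> G z" "u \<in> G w" for u
    proof -
      obtain x where x: "x \<in> S" "fl x = z" "u = x - z"
        using u(1) by (auto simp: G_def)
      obtain y where y: "y \<in> S" "fl y = w" "u = y - w"
        using u(2) by (auto simp: G_def)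
      have "x - y = fl x - fl y"
        using x y by (simp add: algebra_simps)
      then have "x $ i - y $ i = fl x $ i - fl y $ i" for i
        by (metis vector_minus_component)
      then have "x = y"
        using x(1) y(1) by (intro inj) (auto simp: fl_def)
      then show False using x y zw by simp
    qed
    then show "G z \<inter> G w = {}" by auto
  qed
  have "S = (\<Union>z\<in>fl ` S. {x \<in> S. fl x = z})" by auto
  then have "measure lebesgue S = measure lebesgue (\<Union>z\<in>fl ` S. {x \<in> S. fl x = z})"
    by simp
  also have "\<dots> \<le> (\<Sum>z\<in>fl ` S. measure lebesgue {x \<in> S. fl x = z})"
    by (rule measure_UNION_le[OF fin]) (use meas in \<open>auto dest: fmeasurableD\<close>)
  also have "\<dots> = (\<Sum>z\<in>fl ` S. measure lebesgue (G z))"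
    unfolding G_def by (simp add: measure_translation_subtract)
  also have "\<dots> = measure lebesgue (\<Union>z\<in>fl ` S. G z)"
    by (rule measure_UNION'[symmetric, OF fin])
      (use measG disj in \<open>auto simp: disjoint_family_on_def pairwise_def disjnt_def\<close>)
  also have "\<dots> \<le> measure lebesgue (cbox 0 (1::real^'n))"
  proof (rule measure_mono_fmeasurable)
    show "(\<Union>z\<in>fl ` S. G z) \<subseteq> cbox 0 1"
    proof -
      have cube: "x - fl x \<in> cbox 0 1" for x
        by (auto simp: fl_def mem_box_cart) linarith
      have "u \<in> cbox 0 1" if u: "u \<in> G z" for u z
      proof -
        obtain x where "fl x = z" "u = x - z"
          using u by (auto simp: G_def)
        then show ?thesis using cube[of x] by simp
      qed
      then show ?thesis by blast
    qed
    show "(\<Union>z\<in>fl ` S. G z) \<in> sets lebesgue"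
      using fin measG by (intro sets.finite_UN) (auto dest: fmeasurableD)
  qed auto
  also have "\<dots> = 1"
    by (simp add: content_cbox_if_cart interval_eq_empty_cart)
  finally show ?thesis .
qed

section \<open>Volume under linear images\<close>

text \<open>The library's \<open>measure_linear_image\<close> requires a well-ordered index type.\<close>

lemma measure_matrix_image_cbox:
  fixes A :: "real^'n^'n"
  shows "measure lebesgue ((*v) A ` cbox a b) = \<bar>det A\<bar> * measure lebesgue (cbox a b)"
proof -
  \<comment> \<open>The boxes stay universally quantified through the induction: in the product
    case, \<open>measure_linear_sufficient\<close> turns the hypothesis for \<open>A\<close> on all
    boxes into the determinant formula on all measurable sets, in particular on the image of a box
    under \<open>B\<close>.\<close>
  have "\<forall>a b. measure lebesgue ((*v) A ` cbox a b) = \<bar>det A\<bar> * measure lebesgue (cbox a b)"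
  proof (induction A rule: induct_matrix_elementary_alt; intro allI)
    fix A B :: "real^'n^'n" and a b :: "real^'n"
    assume A: "\<forall>a b. measure lebesgue ((*v) A ` cbox a b) = \<bar>det A\<bar> * measure lebesgue (cbox a b)"
      and B: "\<forall>a b. measure lebesgue ((*v) B ` cbox a b) = \<bar>det B\<bar> * measure lebesgue (cbox a b)"
    have "(*v) B ` cbox a b \<in> lmeasurable"
      by (intro measurable_linear_image_interval) auto
    then have "measure lebesgue ((*v) A ` (*v) B ` cbox a b) = \<bar>det A\<bar> * measure lebesgue ((*v) B ` cbox a b)"
      using measure_linear_sufficient[of "(*v) A"] A by auto
    then show "measure lebesgue ((*v) (A ** B) ` cbox a b) = \<bar>det (A ** B)\<bar> * measure lebesgue (cbox a b)"
      using B by (simp add: image_image matrix_vector_mul_assoc det_mul abs_mult)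
  next
    fix A :: "real^'n^'n" and i and a b :: "real^'n"
    assume "row i A = 0"
    then have det: "det A = 0" by (rule det_zero_row)
    then have "\<not> inj ((*v) A)"
      using det_nz_iff_inj[of "(*v) A"] by simp
    then have "negligible ((*v) A ` cbox a b)"
      by (intro negligible_linear_singular_image) auto
    then show "measure lebesgue ((*v) A ` cbox a b) = \<bar>det A\<bar> * measure lebesgue (cbox a b)"
      using det by (simp add: negligible_imp_measure0)
  next
    fix A :: "real^'n^'n" and a b :: "real^'n"
    assume diag: "\<And>i j. i \<noteq> j \<Longrightarrow> A $ i $ j = 0"
    have "(A *v x) $ i = A $ i $ i * x $ i" for x i
      using sum.remove[of UNIV i "\<lambda>j. A $ i $ j * x $ j"] diag
      by (simp add: matrix_vector_mult_def)
    then have "(*v) A = (\<lambda>x. \<chi> i. A $ i $ i * x $ i)"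
      by (auto simp: vec_eq_iff)
    then show "measure lebesgue ((*v) A ` cbox a b) = \<bar>det A\<bar> * measure lebesgue (cbox a b)"
      using measure_stretch[of "cbox a b" "\<lambda>i. A $ i $ i"] diag by (simp add: det_diagonal)
  next
    fix m n :: 'n and a b :: "real^'n"
    let ?\<sigma> = "Transposition.transpose m n"
    let ?M = "(\<chi> i j. mat 1 $ i $ ?\<sigma> j) :: real^'n^'n"
    have perm: "?\<sigma> permutes UNIV" by (simp add: permutes_swap_id)
    have M: "(?M *v x) $ i = x $ ?\<sigma> i" for x i
    proof -
      have "(i = ?\<sigma> j) = (j = ?\<sigma> i)" for j by (metis transpose_involutory)
      then show ?thesis by (simp add: matrix_vector_mult_def mat_def if_distrib[of "\<lambda>u. u * _"] cong: if_cong)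
    qed
    then have inv: "?M *v (?M *v x) = x" for x
      by (simp add: vec_eq_iff)
    have box: "?M *v x \<in> cbox (?M *v a) (?M *v b) \<longleftrightarrow> x \<in> cbox a b" for x
      unfolding mem_box_cart M by (metis transpose_involutory)
    \<comment> \<open>Swapping two coordinates sends a box to the box with swapped corners.
      Surjectivity comes from the swap being its own inverse.\<close>
    have img: "(*v) ?M ` cbox a b = cbox (?M *v a) (?M *v b)"
    proof
      show "(*v) ?M ` cbox a b \<subseteq> cbox (?M *v a) (?M *v b)"
        using box by blast
      show "cbox (?M *v a) (?M *v b) \<subseteq> (*v) ?M ` cbox a b"
      proof
        fix y assume "y \<in> cbox (?M *v a) (?M *v b)"
        then have "?M *v y \<in> cbox a b"
          using box[of "?M *v y"] by (simp only: inv)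
        then show "y \<in> (*v) ?M ` cbox a b"
          by (rule rev_image_eqI) (simp only: inv)
      qed
    qed
    have "(\<Prod>i\<in>UNIV. b $ ?\<sigma> i - a $ ?\<sigma> i) = (\<Prod>i\<in>UNIV. b $ i - a $ i)"
      using prod.permute[OF perm, of "\<lambda>i. b $ i - a $ i"] by (simp add: o_def)
    moreover have "cbox (?M *v a) (?M *v b) = {} \<longleftrightarrow> cbox a b = {}"
      unfolding img[symmetric] by simp
    moreover have "\<bar>det ?M\<bar> = 1"
      using det_permute_columns[OF perm, of "mat 1 :: real^'n^'n"]
      by (simp add: sign_def)
    ultimately show "measure lebesgue ((*v) ?M ` cbox a b) = \<bar>det ?M\<bar> * measure lebesgue (cbox a b)"
      unfolding img by (simp add: content_cbox_if_cart M)
  next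
    fix m n :: 'n and a b :: "real^'n"
    assume mn: "m \<noteq> n"
    let ?E = "(\<chi> i j. of_bool (i = m \<and> j = n \<or> i = j)) :: real^'n^'n"
    have E: "(*v) ?E = (\<lambda>x. \<chi> i. if i = m then x $ m + x $ n else x $ i)"
    proof
      fix x :: "real^'n"
      have "(\<Sum>j\<in>UNIV. of_bool (i = m \<and> j = n \<or> i = j) * x $ j) =
          (\<Sum>j\<in>UNIV. (if j = n then if i = m then x $ j else 0 else 0) + (if j = i then x $ j else 0))" for i
        using mn by (intro sum.cong) auto
      then show "?E *v x = (\<chi> i. if i = m then x $ m + x $ n else x $ i)"
        by (simp add: matrix_vector_mult_def vec_eq_iff sum.distrib)
    qed
    have "?E = (\<chi> k. if k = m then row m (mat 1) + 1 *s row n (mat 1) else row k (mat 1))"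
      using mn by (auto simp: vec_eq_iff row_def mat_def)
    then have "det ?E = det (mat 1 :: real^'n^'n)"
      by (simp only: det_row_operation[OF mn])
    then have det: "det ?E = 1" by simp
    \<comment> \<open>\<open>measure_shear_interval\<close> asks for a lower corner with
      non-negative \<open>n\<close>-th coordinate. Translating by \<open>-v\<close> makes this
      coordinate 0 and changes the volume neither before nor after the shear.\<close>
    define v :: "real^'n" where "v = axis n (a $ n)"
    have "cbox a b = (+) v ` cbox (a - v) (b - v)"
      by (simp flip: cbox_translation)
    then have "measure lebesgue ((*v) ?E ` cbox a b) = measure lebesgue ((+) (?E *v v) ` (*v) ?E ` cbox (a - v) (b - v))"
      by (simp add: image_image matrix_vector_right_distrib)
    also have "\<dots> = measure lebesgue ((*v) ?E ` cbox (a - v) (b - v))"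
      by (rule measure_translation)
    also have "\<dots> = measure lebesgue (cbox (a - v) (b - v))"
    proof (cases "cbox (a - v) (b - v) = {}")
      case False
      then show ?thesis
        unfolding E using mn by (intro measure_shear_interval) (auto simp: v_def)
    qed simp
    also have "\<dots> = measure lebesgue (cbox a b)"
      using measure_translation[of v "cbox (a - v) (b - v)"] by (simp flip: cbox_translation)
    finally show "measure lebesgue ((*v) ?E ` cbox a b) = \<bar>det ?E\<bar> * measure lebesgue (cbox a b)"
      using det by simp
  qed
  then show ?thesis by blast
qed

lemma
  fixes A :: "real^'n^'n"
  assumes "S \<in> lmeasurable"
  shows measurable_matrix_image: "(*v) A ` S \<in> lmeasurable"
    and measure_matrix_image: "measure lebesgue ((*v) A ` S) = \<bar>det A\<bar> * measure lebesgue S"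
  using measure_linear_sufficient[OF matrix_vector_mul_linear assms measure_matrix_image_cbox]
  by simp_all

section \<open>Lattices and bounds for densities\<close>

lemma full_latticeE:
  assumes "full_lattice L"
  obtains B where "invertible B" "L = lattice_gen B" "lattice_det L = \<bar>det B\<bar>" "det B \<noteq> 0"
  using assms lattice_det_eq unfolding full_lattice_def lattice_basis_def
  by (metis invertible_det_nz)

lemma invertible_vector_inverseE:
  fixes B :: "real^'n^'n"
  assumes "invertible B"
  obtains C where "\<And>x. B *v (C *v x) = x" "\<And>x. C *v (B *v x) = x"
proof -
  obtain C where "B ** C = mat 1" "C ** B = mat 1"
    using assms by (auto simp: invertible_def)
  then show ?thesis
    by (intro that[of C]) (simp_all add: matrix_vector_mul_assoc)
qed

lemma lattice_det_pos:
  assumes "full_lattice L"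
  shows "0 < lattice_det L"
  using full_latticeE[OF assms] by (metis zero_less_abs_iff)

lemma lattice_add_diff:
  assumes "full_lattice L" "x \<in> L" "y \<in> L"
  shows "x + y \<in> L" "x - y \<in> L"
proof -
  obtain B where "L = lattice_gen B" using full_latticeE[OF assms(1)] by metis
  then obtain u v where uv: "x = B *v u" "y = B *v v" "\<forall>i. u $ i \<in> \<int>" "\<forall>i. v $ i \<in> \<int>"
    "L = lattice_gen B"
    using assms(2,3) by (auto simp: lattice_gen_def)
  show "x + y \<in> L"
    using uv by (auto simp: lattice_gen_def matrix_vector_right_distrib intro!: exI[of _ "u + v"])
  show "x - y \<in> L"
    using uv by (auto simp: lattice_gen_def matrix_vector_mult_diff_distrib intro!: exI[of _ "u - v"])
qed

lemma translates_density_nonneg: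
  assumes "full_lattice L"
  shows "0 \<le> translates_density K L"
  using lattice_det_pos[OF assms] by (simp add: translates_density_def)

lemma measure_convex_body_pos:
  fixes K :: "(real^'n) set"
  assumes "convex_body K"
  shows "0 < measure lebesgue K"
proof -
  have K: "compact K" "interior K \<noteq> {}"
    using assms by (auto simp: convex_body_def)
  then have "\<not> negligible K"
    using open_not_negligible[OF open_interior K(2)] negligible_subset interior_subset by blast
  then show ?thesis
    using lmeasurable_compact[OF K(1)] negligible_iff_measure
    by (metis measure_nonneg order_less_le)
qed

lemma translates_density_pos:
  assumes "convex_body K" "full_lattice L"
  shows "0 < translates_density K L"
  using lattice_det_pos[OF assms(2)] measure_convex_body_pos[OF assms(1)]
  by (simp add: translates_density_def)

text \<open>Pull \<open>interior K\<close> back by the inverse of a basis matrix. Two points of the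
  result that differ by an integer vector would give a point in the interiors of \<open>K\<close>
  and of a lattice translate of \<open>K\<close>, so the packing property makes them equal and the
  volume is at most 1. The bound is what makes the real \<open>Sup\<close> in
  \<open>lattice_packing_density\<close> an upper bound.\<close>

lemma translates_density_packing_le_1:
  fixes K :: "(real^'n) set"
  assumes "convex_body K" "lattice_packing K L"
  shows "translates_density K L \<le> 1"
proof -
  have K: "compact K" "convex K" using assms(1) by (auto simp: convex_body_def)
  have L: "full_lattice L" "disjoint_family_on (\<lambda>x. interior ((+) x ` K)) L"
    using assms(2) by (auto simp: lattice_packing_def)
  obtain B where B: "invertible B" "L = lattice_gen B" "lattice_det L = \<bar>det B\<bar>" "det B \<noteq> 0"
    using full_latticeE[OF L(1)] by blast
  obtain C where BC: "\<And>x. B *v (C *v x) = x" "\<And>x. C *v (B *v x) = x"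
    using invertible_vector_inverseE[OF B(1)] by blast
  define S where "S = (*v) C ` interior K"
  have bnd: "bounded (interior K)"
    using K(1) compact_imp_bounded bounded_interior by blast
  have intK: "interior K \<in> lmeasurable"
    using K(1) compact_imp_bounded lmeasurable_interior by blast
  have S: "S \<in> lmeasurable" "bounded S"
    using intK bnd unfolding S_def
    by (auto intro: measurable_matrix_image bounded_linear_image)
  have "measure lebesgue S \<le> 1"
  proof (rule measure_le_1_if_distinct_mod_integers[OF S])
    fix x y assume xy: "x \<in> S" "y \<in> S" "\<forall>i. x $ i - y $ i \<in> \<int>"
    define l where "l = B *v (x - y)"
    have "l \<in> L"
      using xy(3) unfolding B(2) lattice_gen_def l_def
      by (auto intro!: exI[of _ "x - y"])
    with lattice_add_diff(2)[OF L(1)] have lL: "l \<in> L" "0 \<in> L"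
      by force+
    have "B *v x \<in> interior K" "B *v y \<in> interior K"
      using xy by (auto simp: S_def BC)
    moreover have "B *v x = l + B *v y"
      by (simp add: l_def matrix_vector_mult_diff_distrib)
    ultimately have "B *v x \<in> interior ((+) l ` K) \<inter> interior ((+) 0 ` K)"
      by (simp only: interior_translation) auto
    then have "l = 0"
      using L(2) lL unfolding disjoint_family_on_def by blast
    then have "C *v (B *v (x - y)) = C *v 0" by (simp add: l_def)
    then show "x = y" by (simp add: BC)
  qed
  moreover have "(*v) B ` S = interior K"
    by (auto simp: S_def image_image BC)
  then have "measure lebesgue (interior K) = \<bar>det B\<bar> * measure lebesgue S"
    using measure_matrix_image[OF S(1), of B] by simp
  moreover have "measure lebesgue (interior K) = measure lebesgue K"
    by (intro measure_interior compact_imp_bounded negligible_convex_frontier K)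
  ultimately have "measure lebesgue K \<le> \<bar>det B\<bar>"
    by (simp add: mult_left_le)
  then show ?thesis
    using B by (simp add: translates_density_def)
qed

lemma translates_density_le_packing_density:
  assumes "convex_body K" "lattice_packing K L"
  shows "translates_density K L \<le> lattice_packing_density K"
  unfolding lattice_packing_density_def
  using assms translates_density_packing_le_1[OF assms(1)]
  by (intro cSup_upper bdd_aboveI[of _ 1]) auto

lemma impassable_density_le:
  assumes "impassable_lattice k K L"
  shows "impassable_density k K \<le> translates_density K L"
  unfolding impassable_density_def
  using assms translates_density_nonneg
  by (intro cInf_lower bdd_belowI[of _ 0]) (auto simp: impassable_lattice_def)

section \<open>Planes that miss all dilates\<close>

lemma full_lattice_scaleR:
  fixes L :: "(real^'n) set"
  assumes "full_lattice L" "c \<noteq> 0"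
  shows "full_lattice ((*\<^sub>R) c ` L)"
    and "lattice_det ((*\<^sub>R) c ` L) = \<bar>c\<bar> ^ CARD('n) * lattice_det L"
proof -
  obtain B where B: "invertible B" "L = lattice_gen B" "lattice_det L = \<bar>det B\<bar>" "det B \<noteq> 0"
    using full_latticeE[OF assms(1)] by blast
  define C where "C = matrix ((*\<^sub>R) c) ** B"
  have mv: "C *v x = c *\<^sub>R (B *v x)" for x
    unfolding C_def by (simp flip: matrix_vector_mul_assoc)
  have det: "det C = c ^ CARD('n) * det B"
    by (simp add: C_def det_mul)
  have "(*\<^sub>R) c ` L = lattice_gen C"
    unfolding B(2) lattice_gen_def mv by auto
  then have basis: "lattice_basis ((*\<^sub>R) c ` L) C"
    using det B(4) assms(2) by (simp add: lattice_basis_def invertible_det_nz)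
  then show "full_lattice ((*\<^sub>R) c ` L)" by (auto simp: full_lattice_def)
  show "lattice_det ((*\<^sub>R) c ` L) = \<bar>c\<bar> ^ CARD('n) * lattice_det L"
    using lattice_det_eq[OF basis] det B(3) by (simp add: abs_mult power_abs)
qed

text \<open>Instead of dilating \<open>K\<close> by \<open>s\<close>, shrink \<open>L\<close> by
  \<open>s\<close>: this multiplies the density by the \<open>n\<close>-th power of
  \<open>s\<close>, still below the infimum, so some plane misses the translates along the shrunken
  lattice. Scaling that plane back by \<open>s\<close> gives \<open>A\<close>. The condition on
  \<open>a\<close> and \<open>x\<close> says that \<open>a\<close> lies outside
  \<open>x + s K\<close>.\<close>

lemma exists_plane_avoiding_dilates:
  fixes K L :: "(real^'n) set"
  assumes "full_lattice L" "0 < s"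
    and less: "s ^ CARD('n) * translates_density K L < impassable_density k K"
  obtains A where "affine_subspace_of_dim k A"
    "\<And>a x. a \<in> A \<Longrightarrow> x \<in> L \<Longrightarrow> (a - x) /\<^sub>R s \<notin> K"
proof -
  define M where "M = (*\<^sub>R) (inverse s) ` L"
  have M: "full_lattice M" "lattice_det M = lattice_det L / s ^ CARD('n)"
    unfolding M_def using full_lattice_scaleR[OF assms(1), of "inverse s"] assms(2)
    by (auto simp: field_simps)
  have "translates_density K M = s ^ CARD('n) * translates_density K L"
    using assms(2) by (simp add: translates_density_def M)
  then have "\<not> impassable_lattice k K M"
    using less impassable_density_le by fastforce
  then obtain A where A: "affine_subspace_of_dim k A" "\<And>x. x \<in> M \<Longrightarrow> A \<inter> (+) x ` K = {}"
    using M(1) unfolding impassable_lattice_def by blast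
  show ?thesis
  proof
    have "linear ((*\<^sub>R) s :: real^'n \<Rightarrow> _)" "inj ((*\<^sub>R) s :: real^'n \<Rightarrow> _)"
      using assms(2) by (auto simp: linear_scaleR inj_on_def)
    then show "affine_subspace_of_dim k ((*\<^sub>R) s ` A)"
      using A(1) unfolding affine_subspace_of_dim_def
      by (simp add: affine_scaling aff_dim_injective_linear_image)
  next
    fix a x assume "a \<in> (*\<^sub>R) s ` A" "x \<in> L"
    then obtain b where b: "b \<in> A" "a = s *\<^sub>R b" by auto
    have "A \<inter> (+) (x /\<^sub>R s) ` K = {}"
      using \<open>x \<in> L\<close> by (intro A(2)) (auto simp: M_def)
    moreover have "b = x /\<^sub>R s + (a - x) /\<^sub>R s"
      using b assms(2) by (simp add: scaleR_diff_right)
    ultimately show "(a - x) /\<^sub>R s \<notin> K"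
      using b(1) by blast
  qed
qed

section \<open>A compact parameter space for directions of planes\<close>

text \<open>Matrices whose columns indexed by \<open>I\<close> are orthonormal and whose other columns vanish;
  their ranges are exactly the subspaces of dimension \<open>card I\<close>, so that this compact set replaces
  the Grassmannian.\<close>

definition frames :: "'n::finite set \<Rightarrow> (real^'n^'n) set" where
  "frames I = {M. \<forall>i j. column i M \<bullet> column j M = (if i = j \<and> i \<in> I then 1 else 0)}"

text \<open>The columns indexed by \<open>I\<close> are orthonormal, hence independent, and each
  other column has norm 0 and so vanishes.\<close>

lemma dim_range_frame:
  fixes M :: "real^'n^'n"
  assumes "M \<in> frames I"
  shows "dim (range ((*v) M)) = card I"
proof -
  have M: "column i M \<bullet> column j M = (if i = j \<and> i \<in> I then 1 else 0)" for i j
    using assms by (simp add: frames_def)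
  let ?W = "(\<lambda>i. column i M) ` I"
  have nz: "0 \<notin> ?W"
    using M by (metis (mono_tags, lifting) image_iff inner_zero_left zero_neq_one)
  have inj: "inj_on (\<lambda>i. column i M) I"
    using M by (metis (mono_tags, lifting) inj_onI zero_neq_one)
  have "pairwise orthogonal ?W"
    using M by (auto simp: pairwise_def orthogonal_def)
  then have ind: "independent ?W"
    using nz by (rule pairwise_orthogonal_independent)
  have "column i M \<in> insert 0 ?W" for i
    using M[of i i] by (cases "i \<in> I") auto
  then have sub: "columns M \<subseteq> insert 0 ?W"
    by (auto simp: columns_def)
  have "?W \<subseteq> columns M" by (auto simp: columns_def)
  then have "dim ?W \<le> dim (columns M)" "dim (columns M) \<le> dim (insert 0 ?W)"
    using sub by (auto intro!: dim_subset)
  then have "dim (columns M) = dim ?W"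
    by (metis dim_span span_insert_0 order_antisym)
  also have "\<dots> = card I"
    using ind inj by (simp add: dim_eq_card_independent card_image)
  finally show ?thesis
    using rank_dim_range[of M] column_rank_def[of M] by simp
qed

text \<open>An orthonormal basis of \<open>T\<close>, written into the columns indexed by
  \<open>I\<close>, gives a range that is contained in \<open>T\<close> and has the same
  dimension.\<close>

lemma subspace_eq_range_frame:
  fixes T :: "(real^'n) set"
  assumes "subspace T" "dim T = card I"
  obtains M where "M \<in> frames I" "range ((*v) M) = T"
proof -
  obtain W where W: "W \<subseteq> T" "pairwise orthogonal W" "\<And>x. x \<in> W \<Longrightarrow> norm x = 1"
    "independent W" "card W = dim T" "span W = T"
    using orthonormal_basis_subspace[OF assms(1)] by metis
  have "finite W" using W(4) by (rule independent_imp_finite)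
  moreover have "finite I" by simp
  ultimately obtain e where e: "bij_betw e I W"
    using W(5) assms(2) finite_same_card_bij by metis
  define M :: "real^'n^'n" where "M = (\<chi> r i. if i \<in> I then e i $ r else 0)"
  have col: "column i M = (if i \<in> I then e i else 0)" for i
    by (simp add: M_def column_def vec_eq_iff)
  have ee: "e i \<bullet> e j = (if i = j then 1 else 0)" if "i \<in> I" "j \<in> I" for i j
  proof (cases "i = j")
    case True
    have "e i \<in> W" using e that(1) by (auto simp: bij_betw_def)
    then show ?thesis using W(3) True by (simp add: norm_eq_1)
  next
    case False
    have "e i \<in> W" "e j \<in> W" "e i \<noteq> e j"
      using e that False by (auto simp: bij_betw_def inj_on_def)
    then show ?thesis using W(2) False by (auto simp: pairwise_def orthogonal_def)
  qed
  have frame: "M \<in> frames I"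
    by (auto simp: frames_def col ee)
  have "columns M \<subseteq> T"
    using W(1) e subspace_0[OF assms(1)] by (auto simp: columns_def col bij_betw_def)
  then have "span (columns M) \<subseteq> T"
    using assms(1) by (rule span_minimal)
  then have "range ((*v) M) \<subseteq> T"
    using matrix_vector_mult_in_columnspace[of M] by auto
  moreover have "subspace (range ((*v) M))"
    by (intro linear_subspace_image) auto
  moreover have "dim (range ((*v) M)) = dim T"
    using dim_range_frame[OF frame] assms(2) by simp
  ultimately have "range ((*v) M) = T"
    using assms(1) by (intro subspace_dim_equal) auto
  then show ?thesis using frame that by blast
qed

lemma affine_subspace_of_dim_iff_frame:
  fixes A :: "(real^'n) set"
  shows "affine_subspace_of_dim (card I) A \<longleftrightarrow>
    (\<exists>p. \<exists>M\<in>frames I. A = (+) p ` range ((*v) M))"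
proof
  assume A: "affine_subspace_of_dim (card I) A"
  then have "A \<noteq> {}" by (auto simp: affine_subspace_of_dim_def)
  then obtain p where p: "p \<in> A" by blast
  define T where "T = (+) (- p) ` A"
  have T: "subspace T"
    using A p unfolding T_def affine_subspace_of_dim_def by (intro affine_diffs_subspace) auto
  moreover have "int (dim T) = int (card I)"
    using A aff_dim_subspace[OF T] unfolding affine_subspace_of_dim_def T_def
    by (simp only: aff_dim_translation_eq)
  ultimately obtain M where M: "M \<in> frames I" "range ((*v) M) = T"
    using subspace_eq_range_frame[of T I] by auto
  have "A = (+) p ` T" by (auto simp: T_def image_image)
  then show "\<exists>p. \<exists>M\<in>frames I. A = (+) p ` range ((*v) M)" using M by blast
next
  assume "\<exists>p. \<exists>M\<in>frames I. A = (+) p ` range ((*v) M)"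
  then obtain p M where M: "M \<in> frames I" and A: "A = (+) p ` range ((*v) M)" by blast
  have T: "subspace (range ((*v) M))"
    by (intro linear_subspace_image) auto
  show "affine_subspace_of_dim (card I) A"
    unfolding affine_subspace_of_dim_def A
    using T aff_dim_subspace[OF T] dim_range_frame[OF M] affine_translation subspace_imp_affine
    by (metis aff_dim_translation_eq)
qed

text \<open>Closed because the defining equations are continuous in the entries, and bounded because
  every column has norm at most 1.\<close>

lemma compact_frames: "compact (frames I :: (real^'n^'n) set)"
proof -
  have "closed (frames I :: (real^'n^'n) set)"
    unfolding frames_def column_def
    by (intro closed_Collect_all closed_Collect_eq continuous_intros)
  moreover have "norm M \<le> real CARD('n) * real CARD('n)" if M: "M \<in> frames I" for M :: "real^'n^'n"
  proof -
    have "\<bar>M $ r $ i\<bar> \<le> 1" for r i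
    proof -
      have "norm (column i M) \<le> 1"
        using M by (auto simp: frames_def norm_eq_sqrt_inner)
      then show ?thesis
        using component_le_norm_cart[of "column i M" r] by (simp add: column_def)
    qed
    then have "norm (M $ r) \<le> real CARD('n)" for r
      using norm_le_l1_cart[of "M $ r"] sum_bounded_above[of UNIV "\<lambda>i. \<bar>M $ r $ i\<bar>" 1]
      by force
    then have "(\<Sum>r\<in>UNIV. norm (M $ r)) \<le> real CARD('n) * real CARD('n)"
      using sum_bounded_above[of UNIV "\<lambda>r. norm (M $ r)" "real CARD('n)"] by simp
    then show ?thesis
      using L2_set_le_sum[of UNIV "\<lambda>r. norm (M $ r)"] by (simp add: norm_vec_def)
  qed
  then have "bounded (frames I :: (real^'n^'n) set)"
    by (auto simp: bounded_iff)
  ultimately show ?thesis by (simp add: compact_eq_bounded_closed)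
qed

section \<open>Passage to a limit of planes\<close>

text \<open>\<open>C\<close> is the fundamental parallelepiped of a basis. The lattice vector to
  subtract has the integer parts of the coordinates of \<open>p\<close> in that basis.\<close>

lemma compact_lattice_reduction:
  fixes L :: "(real^'n) set"
  assumes "full_lattice L"
  obtains C where "compact C" "\<And>p. \<exists>x\<in>L. p - x \<in> C"
proof -
  obtain B where B: "invertible B" "L = lattice_gen B"
    using full_latticeE[OF assms] by metis
  obtain C where C: "\<And>x. B *v (C *v x) = x"
    using invertible_vector_inverseE[OF B(1)] by blast
  show ?thesis
  proof
    show "compact ((*v) B ` cbox 0 1)"
      by (intro compact_continuous_image matrix_vector_mult_linear_continuous_on compact_cbox)
  next
    fix p :: "real^'n"
    define y where "y = C *v p"
    define z where "z = (\<chi> i. real_of_int \<lfloor>y $ i\<rfloor>)"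
    have "p = B *v y"
      by (simp add: y_def C)
    then have "p - B *v z = B *v (y - z)"
      by (simp add: matrix_vector_mult_diff_distrib)
    moreover have "y - z \<in> cbox 0 1"
      by (auto simp: mem_box_cart z_def) linarith
    moreover have "B *v z \<in> L"
      unfolding B(2) lattice_gen_def z_def by auto
    ultimately show "\<exists>x\<in>L. p - x \<in> (*v) B ` cbox 0 1" by force
  qed
qed

text \<open>Lattice translations move the base points of the planes into a compact set, so a
  subsequence of the planes converges.\<close>

lemma plane_avoiding_limit_dilate:
  fixes K L :: "(real^'n) set"
  assumes L: "full_lattice L" and k: "k \<le> CARD('n)"
    and s: "s \<longlonglongrightarrow> t" "0 < t"
    and planes: "\<And>j. \<exists>A. affine_subspace_of_dim k A \<and> (\<forall>a\<in>A. \<forall>x\<in>L. (a - x) /\<^sub>R s j \<notin> K)"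
  obtains A where "affine_subspace_of_dim k A"
    "\<And>a x. a \<in> A \<Longrightarrow> x \<in> L \<Longrightarrow> (a - x) /\<^sub>R t \<notin> interior K"
proof -
  obtain I :: "'n set" where I: "card I = k"
    using k obtain_subset_with_card_n by metis
  obtain C where C: "compact C" "\<And>p. \<exists>x\<in>L. p - x \<in> C"
    using compact_lattice_reduction[OF L] by metis
  have "\<exists>P. P \<in> C \<times> frames I \<and> (\<forall>v. \<forall>x\<in>L. (fst P + snd P *v v - x) /\<^sub>R s j \<notin> K)" for j
  proof -
    obtain A where A: "affine_subspace_of_dim (card I) A"
      "\<And>a x. a \<in> A \<Longrightarrow> x \<in> L \<Longrightarrow> (a - x) /\<^sub>R s j \<notin> K"
      using planes[of j] I by auto
    obtain p M where M: "M \<in> frames I" "A = (+) p ` range ((*v) M)"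
      using A(1) affine_subspace_of_dim_iff_frame by metis
    \<comment> \<open>Since \<open>L\<close> is closed under addition, translating the plane by
      \<open>-y\<close> keeps it clear of all dilates, while its base point \<open>p - y\<close>
      lies in \<open>C\<close>.\<close>
    obtain y where y: "y \<in> L" "p - y \<in> C" using C(2) by blast
    have "(p - y + M *v v - x) /\<^sub>R s j \<notin> K" if "x \<in> L" for v x
    proof -
      have "(p + M *v v - (y + x)) /\<^sub>R s j \<notin> K"
        using M(2) lattice_add_diff(1)[OF L y(1) that] by (intro A(2)) auto
      moreover have "p + M *v v - (y + x) = p - y + M *v v - x" by simp
      ultimately show ?thesis by simp
    qed
    then show ?thesis
      using M(1) y(2) by (intro exI[of _ "(p - y, M)"]) auto
  qed
  then obtain P where P: "\<And>j. P j \<in> C \<times> frames I"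
    "\<And>j v x. x \<in> L \<Longrightarrow> (fst (P j) + snd (P j) *v v - x) /\<^sub>R s j \<notin> K"
    by metis
  have "seq_compact (C \<times> frames I)"
    using compact_Times[OF C(1) compact_frames] by (rule compact_imp_seq_compact)
  then obtain p r where p: "p \<in> C \<times> frames I" and r: "strict_mono r" "(P \<circ> r) \<longlonglongrightarrow> p"
    using P(1) by (metis seq_compactE)
  show ?thesis
  proof
    show "affine_subspace_of_dim k ((+) (fst p) ` range ((*v) (snd p)))"
      unfolding I[symmetric] affine_subspace_of_dim_iff_frame using p by (auto simp: mem_Times_iff)
  next
    fix a x assume "a \<in> (+) (fst p) ` range ((*v) (snd p))" and x: "x \<in> L"
    then obtain v where v: "a = fst p + snd p *v v" by auto
    \<comment> \<open>\<open>f j\<close> comes from the point with the same parameter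
      \<open>v\<close> on the \<open>r j\<close>-th plane. These points converge to
      \<open>(a - x) /\<^sub>R t\<close>. If the limit lay in the open set
      \<open>interior K\<close>, then so would \<open>f j\<close> for large \<open>j\<close>,
      although every \<open>f j\<close> is outside \<open>K\<close>. Nothing excludes a limit on the
      boundary of \<open>K\<close>.\<close>
    define f where "f j = (fst (P (r j)) + snd (P (r j)) *v v - x) /\<^sub>R s (r j)" for j
    have "(\<lambda>j. fst (P (r j))) \<longlonglongrightarrow> fst p" "(\<lambda>j. snd (P (r j))) \<longlonglongrightarrow> snd p"
      using tendsto_fst[OF r(2)] tendsto_snd[OF r(2)] by (auto simp: o_def)
    moreover from this(2) have "(\<lambda>j. snd (P (r j)) *v v) \<longlonglongrightarrow> snd p *v v"
      unfolding matrix_vector_mult_def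
      by (intro vec_tendstoI) (auto intro!: tendsto_intros)
    moreover have "(\<lambda>j. s (r j)) \<longlonglongrightarrow> t"
      using LIMSEQ_subseq_LIMSEQ[OF s(1) r(1)] by (simp add: o_def)
    ultimately have "f \<longlonglongrightarrow> (a - x) /\<^sub>R t"
      unfolding f_def v using s(2) by (auto intro!: tendsto_intros)
    then have "(a - x) /\<^sub>R t \<in> interior K \<Longrightarrow> eventually (\<lambda>j. f j \<in> interior K) sequentially"
      by (rule topological_tendstoD) auto
    moreover have "f j \<notin> interior K" for j
      unfolding f_def using P(2)[OF x] interior_subset by blast
    ultimately show "(a - x) /\<^sub>R t \<notin> interior K" by auto
  qed
qed

section \<open>From the limit plane to the Minkowski sum\<close>

lemma interior_sum_disjoint_translate:
  fixes K :: "'a::euclidean_space set"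
  assumes "convex K" "interior K \<noteq> {}" and t: "1 \<le> t"
    and avoid: "\<And>a. a \<in> A \<Longrightarrow> (a - x) /\<^sub>R t \<notin> interior K"
  shows "interior (A + (*\<^sub>R) (t - 1) ` uminus ` K) \<inter> (+) x ` K = {}"
proof (rule ccontr)
  let ?S = "A + (*\<^sub>R) (t - 1) ` uminus ` K"
  assume "interior ?S \<inter> (+) x ` K \<noteq> {}"
  then obtain y where y: "y \<in> K" "x + y \<in> interior ?S" by auto
  obtain z where z: "z \<in> interior K" using assms(2) by blast
  \<comment> \<open>The point \<open>y\<close> may lie on the boundary of \<open>K\<close>. As the
    interior of the sum is open, \<open>x + y\<close> can be moved a little towards
    \<open>x + z\<close> without leaving it, which replaces \<open>y\<close> by a point
    \<open>m\<close> of \<open>interior K\<close>.\<close>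
  have "((\<lambda>e. x + (y - e *\<^sub>R (y - z))) \<longlongrightarrow> x + (y - 0 *\<^sub>R (y - z))) (at_right 0)"
    by (intro tendsto_intros)
  then have "eventually (\<lambda>e. x + (y - e *\<^sub>R (y - z)) \<in> interior ?S) (at_right (0::real))"
    by (rule topological_tendstoD) (use y in auto)
  moreover have "eventually (\<lambda>e. 0 < e \<and> e < 1) (at_right (0::real))"
    using eventually_at_right_real[of 0 1] by simp
  ultimately have "eventually (\<lambda>e. x + (y - e *\<^sub>R (y - z)) \<in> interior ?S \<and> 0 < e \<and> e < 1)
      (at_right (0::real))"
    by (rule eventually_conj)
  then obtain e where e: "0 < e" "e < 1" "x + (y - e *\<^sub>R (y - z)) \<in> interior ?S"
    using eventually_happens'[OF trivial_limit_at_right_real] by blast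
  define m where "m = y - e *\<^sub>R (y - z)"
  have m: "m \<in> interior K"
    unfolding m_def using e by (intro mem_interior_convex_shrink assms z y) auto
  have "x + m \<in> ?S"
    using e(3) interior_subset m_def by blast
  then obtain a w where aw: "a \<in> A" "w \<in> K" "x + m = a + (t - 1) *\<^sub>R (- w)"
    by (auto simp: set_plus_def)
  \<comment> \<open>Rearranging gives \<open>a - x = m + (t - 1) w\<close>. Divided by
    \<open>t\<close>, this is the convex combination of \<open>m\<close> and \<open>w\<close> with
    weights \<open>1/t\<close> and \<open>1 - 1/t\<close>. It is interior because \<open>m\<close>
    is and \<open>1/t\<close> is positive.\<close>
  have "w - (1/t) *\<^sub>R (w - m) \<in> interior K"
    using t by (intro mem_interior_convex_shrink assms m aw) auto
  moreover have "a - x = t *\<^sub>R (w - (1/t) *\<^sub>R (w - m))"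
    using aw(3) t by (simp add: algebra_simps)
  then have "(a - x) /\<^sub>R t = w - (1/t) *\<^sub>R (w - m)"
    using t by simp
  ultimately show False using avoid[OF aw(1)] by simp
qed

theorem theorem3p25:
  fixes K L :: "(real^'n) set" and k :: nat
  assumes "1 \<le> k" and "k \<le> CARD('n) - 1"
    and "convex_body K"
    and "lattice_packing_density K < impassable_density k K"
    and "lattice_packing K L"
  shows "\<exists>A :: (real^'n) set. affine_subspace_of_dim k A \<and>
    interior (A + (*\<^sub>R)
        (root CARD('n) (impassable_density k K / lattice_packing_density K) - 1) ` uminus ` K)
      \<inter> (\<Union>x\<in>L. (+) x ` K) = {}"
proof -
  let ?d = "impassable_density k K" and ?\<delta> = "lattice_packing_density K"
  define t where "t = root CARD('n) (?d / ?\<delta>)"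
  have L: "full_lattice L" using assms(5) by (simp add: lattice_packing_def)
  have dens: "0 < translates_density K L" "translates_density K L \<le> ?\<delta>"
    using translates_density_pos[OF assms(3) L]
      translates_density_le_packing_density[OF assms(3,5)] by auto
  \<comment> \<open>The positive density of \<open>L\<close> itself forces \<delta> to be positive,
    so the quotient is not the default value of a division by 0.\<close>
  then have pos: "0 < ?\<delta>" "1 < ?d / ?\<delta>" using assms(4) by auto
  then have t: "1 < t" "t ^ CARD('n) = ?d / ?\<delta>"
    by (auto simp: t_def)
  \<comment> \<open>The summand 2 keeps every factor strictly between 0 and 1: already
    \<open>s 0 = t/2\<close> is positive.\<close>
  define s where "s j = t * (1 - 1 / (real j + 2))" for j
  have "(\<lambda>j. 1 / (real j + 2)) \<longlonglongrightarrow> 0"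
    using LIMSEQ_ignore_initial_segment[OF lim_1_over_n[where 'a=real], of 2]
    by (simp add: add.commute)
  then have "s \<longlonglongrightarrow> t * (1 - 0)"
    unfolding s_def by (intro tendsto_intros)
  then have lim: "s \<longlonglongrightarrow> t" by simp
  have "\<exists>A. affine_subspace_of_dim k A \<and> (\<forall>a\<in>A. \<forall>x\<in>L. (a - x) /\<^sub>R s j \<notin> K)" for j
  proof -
    have s: "0 < s j" "s j < t"
      using t(1) by (auto simp: s_def field_simps add_pos_nonneg)
    then have "s j ^ CARD('n) < t ^ CARD('n)"
      by (intro power_strict_mono) auto
    \<comment> \<open>The strict inequality must come from \<open>s j < t\<close>, because the
      density of \<open>L\<close> may equal \<delta> in the next step of the chain.\<close>
    then have "s j ^ CARD('n) * translates_density K L < ?d / ?\<delta> * translates_density K L"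
      using dens(1) unfolding t(2) by (rule mult_strict_right_mono)
    also have "\<dots> \<le> ?d / ?\<delta> * ?\<delta>"
      using dens pos by (intro mult_left_mono) auto
    also have "\<dots> = ?d" using pos by simp
    finally show ?thesis
      using exists_plane_avoiding_dilates[OF L s(1)] by metis
  qed
  moreover have "k \<le> CARD('n)" "0 < t" using assms(2) t(1) by auto
  ultimately obtain A where A: "affine_subspace_of_dim k A"
    "\<And>a x. a \<in> A \<Longrightarrow> x \<in> L \<Longrightarrow> (a - x) /\<^sub>R t \<notin> interior K"
    using plane_avoiding_limit_dilate[OF L _ lim, of k K] by blast
  have "interior (A + (*\<^sub>R) (t - 1) ` uminus ` K) \<inter> (+) x ` K = {}" if "x \<in> L" for x
    using assms(3) t(1) A(2)[OF _ that]
    by (intro interior_sum_disjoint_translate) (auto simp: convex_body_def)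
  then show ?thesis
    using A(1) unfolding t_def by blast
qed

end
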